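(* Let $R$ be a connected graph on $r$ vertices, $B_k$ a generalized Bethe tree on $k\ge 2$ levels, $\alpha\in[0,1)$, and let $\rho_1(\alpha),\dots,\rho_r(\alpha)$ be the eigenvalues of $A_\alpha(R)$ with $\rho_1(\alpha)$ its spectral radius. Then: (1) $\mathrm{Spec}(A_\alpha(R\{B_k\}))=\big(\bigcup_{j=1}^{k-1}\mathrm{Spec}(T_j)\big)\cup\big(\bigcup_{i=1}^r\mathrm{Spec}(S_i)\big)$; (2) more precisely, for $1\le j\le k-1$ each eigenvalue of $T_j$ occurs as an eigenvalue of $A_\alpha(R\{B_k\})$ with multiplicity $r(n_j-n_{j+1})$ (contributed by $T_j$), and for $1\le i\le r$ each eigenvalue of $S_i$ contributes multiplicity one; if eigenvalues coming from different matrices coincide, the multiplicities add; (3) the largest eigenvalue of $S_1$ is the spectral radius of $A_\alpha(R\{B_k\})$.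
   Context: $A_\alpha(G)=\alpha D(G)+(1-\alpha)A(G)$ ($D$ degree matrix, $A$ adjacency matrix); $\beta=1-\alpha$. $R\{H\}$ is obtained from $R$ (vertices $v_1,\dots,v_r$) and $r$ copies of the rooted graph $H$ by identifying the root of the $i$-th copy with $v_i$. A generalized Bethe tree is a rooted tree in which all vertices at the same level have the same degree (root at level 1, level = distance to root plus one); $B_k$ has $k$ levels. For $1\le j\le k$, $n_j$ and $d_j$ are the number and common degree of the vertices of $B_k$ at level $k-j+1$ (so $n_k=1$, $d_1=1$, $d_k$ is the root degree). $T_k$ is the $k\times k$ symmetric tridiagonal matrix with diagonal $(\alpha,\alpha d_2,\dots,\alpha d_{k-1},\alpha d_k)$ and off-diagonal entries in positions $(j,j+1),(j+1,j)$ equal to $\beta\sqrt{d_{j+1}-1}$ for $1\le j\le k-2$ and $\beta\sqrt{d_k}$ for $j=k-1$; for $1\le j\le k-1$, $T_j$ is the $j\times j$ leading principal submatrix of $T_k$. For $1\le i\le r$, $S_i$ is $T_k$ with its $(k,k)$ entry replaced by $\alpha d_k+\rho_i(\alpha)$. Spectra are multisets.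
   Formalization: In (1) the union of the spectra of T_j is taken only over those j with n_j > n_{j+1}; over all j it fails, e.g. for R a single vertex and B_2 a single edge, where T_1 = (α) has multiplicity 0 and α is not an eigenvalue. *)

theory Defs
  imports "Jordan_Normal_Form.Spectral_Radius" "HOL-Computational_Algebra.Polynomial"
begin

definition simple_graph :: "nat \<Rightarrow> (nat \<Rightarrow> nat \<Rightarrow> bool) \<Rightarrow> bool" where
  "simple_graph n E \<longleftrightarrow> (\<forall>u v. E u v \<longrightarrow> u < n \<and> v < n \<and> u \<noteq> v \<and> E v u)"

fun walk :: "(nat \<Rightarrow> nat \<Rightarrow> bool) \<Rightarrow> nat \<Rightarrow> nat \<Rightarrow> nat \<Rightarrow> bool" where
  "walk E 0 u v \<longleftrightarrow> u = v"
| "walk E (Suc m) u v \<longleftrightarrow> (\<exists>w. E u w \<and> walk E m w v)"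

definition connected_graph :: "nat \<Rightarrow> (nat \<Rightarrow> nat \<Rightarrow> bool) \<Rightarrow> bool" where
  "connected_graph n E \<longleftrightarrow> simple_graph n E \<and> n \<ge> 1 \<and>
     (\<forall>u<n. \<forall>v<n. \<exists>m. walk E m u v)"

definition gdist :: "(nat \<Rightarrow> nat \<Rightarrow> bool) \<Rightarrow> nat \<Rightarrow> nat \<Rightarrow> nat" where
  "gdist E u v = (LEAST m. walk E m u v)"

definition gdeg :: "nat \<Rightarrow> (nat \<Rightarrow> nat \<Rightarrow> bool) \<Rightarrow> nat \<Rightarrow> nat" where
  "gdeg n E v = card {w. w < n \<and> E v w}"

definition is_tree :: "nat \<Rightarrow> (nat \<Rightarrow> nat \<Rightarrow> bool) \<Rightarrow> bool" where
  "is_tree N E \<longleftrightarrow> connected_graph N E \<and>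
     card {(u, v). u < v \<and> v < N \<and> E u v} = N - 1"

definition level :: "(nat \<Rightarrow> nat \<Rightarrow> bool) \<Rightarrow> nat \<Rightarrow> nat" where
  "level E v = gdist E 0 v + 1"

definition gen_bethe_tree :: "nat \<Rightarrow> (nat \<Rightarrow> nat \<Rightarrow> bool) \<Rightarrow> nat \<Rightarrow> bool" where
  "gen_bethe_tree N E k \<longleftrightarrow> is_tree N E \<and>
     (\<forall>u<N. \<forall>v<N. level E u = level E v \<longrightarrow> gdeg N E u = gdeg N E v) \<and>
     k = Max (level E ` {0..<N})"

definition bethe_n :: "nat \<Rightarrow> (nat \<Rightarrow> nat \<Rightarrow> bool) \<Rightarrow> nat \<Rightarrow> nat \<Rightarrow> nat" where
  "bethe_n N E k j = card {v. v < N \<and> level E v = k - j + 1}"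

definition bethe_d :: "nat \<Rightarrow> (nat \<Rightarrow> nat \<Rightarrow> bool) \<Rightarrow> nat \<Rightarrow> nat \<Rightarrow> nat" where
  "bethe_d N E k j = gdeg N E (SOME v. v < N \<and> level E v = k - j + 1)"

definition A_alpha :: "real \<Rightarrow> nat \<Rightarrow> (nat \<Rightarrow> nat \<Rightarrow> bool) \<Rightarrow> real mat" where
  "A_alpha \<alpha> n E = mat n n (\<lambda>(u, v). if u = v then \<alpha> * real (gdeg n E u)
       else if E u v then 1 - \<alpha> else 0)"

text \<open>R{B}: copy i of the tree B (vertices {0..<N}, root 0) occupies vertices
  i*N + u (u < N); the root of copy i is identified with vertex i of R.\<close>
definition rooted_product :: "nat \<Rightarrow> (nat \<Rightarrow> nat \<Rightarrow> bool) \<Rightarrow> nat \<Rightarrow> (nat \<Rightarrow> nat \<Rightarrow> bool)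
    \<Rightarrow> nat \<Rightarrow> nat \<Rightarrow> bool" where
  "rooted_product r ER N EB p q \<longleftrightarrow> p < r * N \<and> q < r * N \<and>
     ((p div N = q div N \<and> EB (p mod N) (q mod N)) \<or>
      (p mod N = 0 \<and> q mod N = 0 \<and> ER (p div N) (q div N)))"

definition spec :: "real mat \<Rightarrow> real multiset" where
  "spec A = proots (char_poly A)"

text \<open>The tridiagonal matrix T_k with entry (k,k) replaced by c (0-based indices).
  d is the degree sequence d_1..d_k.\<close>
definition tridiag_mat :: "real \<Rightarrow> (nat \<Rightarrow> nat) \<Rightarrow> nat \<Rightarrow> real \<Rightarrow> real mat" where
  "tridiag_mat \<alpha> d k c = mat k k (\<lambda>(a, b).
     if a = b then (if a = k - 1 then c else \<alpha> * real (d (a + 1)))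
     else if b = a + 1 then
        (if a + 1 \<le> k - 2 then (1 - \<alpha>) * sqrt (real (d (a + 2)) - 1) else (1 - \<alpha>) * sqrt (real (d k)))
     else if a = b + 1 then
        (if b + 1 \<le> k - 2 then (1 - \<alpha>) * sqrt (real (d (b + 2)) - 1) else (1 - \<alpha>) * sqrt (real (d k)))
     else 0)"

definition T_mat :: "real \<Rightarrow> (nat \<Rightarrow> nat) \<Rightarrow> nat \<Rightarrow> real mat" where
  "T_mat \<alpha> d k = tridiag_mat \<alpha> d k (\<alpha> * real (d k))"

definition T_sub :: "real \<Rightarrow> (nat \<Rightarrow> nat) \<Rightarrow> nat \<Rightarrow> nat \<Rightarrow> real mat" where
  "T_sub \<alpha> d k j = mat j j (\<lambda>(a, b). T_mat \<alpha> d k $$ (a, b))"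

definition S_mat :: "real \<Rightarrow> (nat \<Rightarrow> nat) \<Rightarrow> nat \<Rightarrow> real \<Rightarrow> real mat" where
  "S_mat \<alpha> d k \<rho> = tridiag_mat \<alpha> d k (\<alpha> * real (d k) + \<rho>)"

end

theory Submission
  imports Defs
begin

text \<open>Gaussian elimination of \<open>x I - G\<close> from the leaves towards the roots of the trees gives every
  vertex with index \<open>j\<close> (that is, at level \<open>k - j + 1\<close>) the same pivot \<open>P j / P (j - 1)\<close>, where
  \<open>P j\<close> is the characteristic polynomial of \<open>T_j\<close> at \<open>x\<close>, and leaves \<open>c I - A_alpha(R)\<close> on the roots,
  where \<open>c - \<rho>_i\<close> is the quotient of the characteristic polynomials of \<open>S_i\<close> and \<open>T_(k-1)\<close>.
  Multiplying the pivots gives the characteristic polynomial of \<open>G\<close>, hence its spectrum.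

  If \<open>l\<close> is the largest root of the characteristic polynomial of \<open>S_1\<close>, then all pivots of \<open>S_1\<close>
  are positive beyond \<open>l\<close>. As \<open>\<bar>\<rho>_i\<bar> \<le> \<rho>_1\<close>, the recurrence of the pivots shows that for complex
  \<open>z\<close> with \<open>\<bar>z\<bar> > l\<close> the pivots of all \<open>T_j\<close> and \<open>S_i\<close> at \<open>z\<close> are at least those of \<open>S_1\<close> at \<open>\<bar>z\<bar>\<close>
  in absolute value, so \<open>z\<close> is not an eigenvalue.\<close>

section \<open>Determinants and tridiagonal matrices\<close>

text \<open>In the Leibniz formula a permutation with nonzero product raises \<open>lev\<close> at
  every moved point, while the sum of \<open>lev\<close> is invariant under permutations; only the
  identity survives. This avoids sorting the indices by level.\<close>

lemma det_level_triangular: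
  fixes f :: "nat \<Rightarrow> nat \<Rightarrow> 'a :: comm_ring_1" and lev :: "nat \<Rightarrow> int"
  assumes tri: "\<And>i j. i < n \<Longrightarrow> j < n \<Longrightarrow> i \<noteq> j \<Longrightarrow> f i j \<noteq> 0 \<Longrightarrow> lev i < lev j"
  shows "det (mat n n (\<lambda>(i, j). f i j)) = (\<Prod>i<n. f i i)"
proof -
  have zero: "(\<Prod>i = 0..<n. f i (p i)) = 0" if p: "p permutes {0..<n}" "p \<noteq> id" for p
  proof (rule ccontr)
    assume nz: "\<not> ?thesis"
    have nz': "f i (p i) \<noteq> 0" if "i < n" for i
      using nz that by (metis atLeast0LessThan finite_atLeastLessThan lessThan_iff prod_zero)
    have pn: "p i < n" if "i < n" for i
      using permutes_in_image[OF p(1), of i] that by auto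
    have le: "lev i \<le> lev (p i)" if "i < n" for i
      using tri[OF that pn[OF that] _ nz'[OF that]] by (cases "i = p i") auto
    from p obtain i0 where i0: "p i0 \<noteq> i0" by (auto simp: fun_eq_iff)
    then have i0n: "i0 < n" using p(1) unfolding permutes_def by auto
    have "lev i0 < lev (p i0)" using tri[OF i0n pn[OF i0n] _ nz'[OF i0n]] i0 by auto
    then have "(\<Sum>i\<in>{0..<n}. lev i) < (\<Sum>i\<in>{0..<n}. lev (p i))"
      by (intro sum_strict_mono_ex1) (use i0n le in auto)
    moreover have "(\<Sum>i\<in>{0..<n}. lev (p i)) = (\<Sum>i\<in>{0..<n}. lev i)"
      using sum.permute[OF p(1), of lev] by (simp add: o_def)
    ultimately show False by simp
  qed
  have "det (mat n n (\<lambda>(i, j). f i j)) =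
      (\<Sum>p | p permutes {0..<n}. signof p * (\<Prod>i = 0..<n. mat n n (\<lambda>(i, j). f i j) $$ (i, p i)))"
    by (rule det_def') auto
  also have "\<dots> = (\<Sum>p | p permutes {0..<n}. signof p * (\<Prod>i = 0..<n. f i (p i)))"
  proof (rule sum.cong[OF refl])
    fix p assume "p \<in> {p. p permutes {0..<n}}"
    then have "p i < n" if "i < n" for i using permutes_in_image[of p "{0..<n}" i] that by auto
    then show "signof p * (\<Prod>i = 0..<n. mat n n (\<lambda>(i, j). f i j) $$ (i, p i)) =
        signof p * (\<Prod>i = 0..<n. f i (p i))"
      by (intro arg_cong2[of _ _ _ _ "(*)"] refl prod.cong) auto
  qed
  also have "\<dots> = (\<Sum>p\<in>{id}. signof p * (\<Prod>i = 0..<n. f i (p i)))"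
    by (rule sum.mono_neutral_right) (auto simp: finite_permutations permutes_id zero)
  finally show ?thesis by (simp add: atLeast0LessThan)
qed

text \<open>The matrix of \<open>f\<close> is \<open>I + c\<close> times that of \<open>g\<close>,
  and \<open>I + c\<close> is unitriangular with respect to \<open>lev\<close>.\<close>

lemma det_add_higher_rows:
  fixes f g c :: "nat \<Rightarrow> nat \<Rightarrow> 'a :: comm_ring_1" and lev :: "nat \<Rightarrow> int"
  assumes c: "\<And>u v. u < n \<Longrightarrow> v < n \<Longrightarrow> c u v \<noteq> 0 \<Longrightarrow> lev u < lev v"
    and f: "\<And>u w. u < n \<Longrightarrow> w < n \<Longrightarrow> f u w = g u w + (\<Sum>v<n. c u v * g v w)"
  shows "det (mat n n (\<lambda>(i, j). f i j)) = det (mat n n (\<lambda>(i, j). g i j))"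
proof -
  define L where "L = mat n n (\<lambda>(u, v). (if u = v then 1 else 0) + c u v)"
  have "mat n n (\<lambda>(i, j). f i j) = L * mat n n (\<lambda>(i, j). g i j)"
    by (rule eq_matI)
      (auto simp: L_def f scalar_prod_def atLeast0LessThan distrib_right sum.distrib
        if_distrib[of "\<lambda>x. x * _"] sum.delta cong: if_cong)
  then have "det (mat n n (\<lambda>(i, j). f i j)) = det L * det (mat n n (\<lambda>(i, j). g i j))"
    by (simp add: det_mult[of _ n] L_def)
  moreover have "det L = (\<Prod>i<n. (if i = i then 1 else 0) + c i i)"
    unfolding L_def by (rule det_level_triangular[of n _ lev]) (auto simp: c split: if_splits)
  moreover have "c i i = 0" if "i < n" for i using c[of i i] that by auto
  ultimately show ?thesis by simp
qed

lemma det_permute_both: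
  fixes f :: "nat \<Rightarrow> nat \<Rightarrow> 'a :: comm_ring_1"
  assumes p: "p permutes {0..<n}"
  shows "det (mat n n (\<lambda>(i, j). f (p i) (p j))) = det (mat n n (\<lambda>(i, j). f i j))"
proof -
  have pn: "p i < n" if "i < n" for i using permutes_in_image[OF p, of i] that by auto
  let ?A = "mat n n (\<lambda>(i, j). f i j)"
  let ?B = "mat n n (\<lambda>(i, j). f i (p j))"
  have "mat n n (\<lambda>(i, j). f (p i) (p j)) = mat n n (\<lambda>(i, j). ?B $$ (p i, j))"
    by (rule eq_matI) (auto simp: pn)
  then have 1: "det (mat n n (\<lambda>(i, j). f (p i) (p j))) = signof p * det ?B"
    using det_permute_rows[OF _ p, of ?B] by simp
  have "transpose_mat ?B = mat n n (\<lambda>(i, j). transpose_mat ?A $$ (p i, j))"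
    by (rule eq_matI) (auto simp: pn)
  then have "det (transpose_mat ?B) = signof p * det (transpose_mat ?A)"
    using det_permute_rows[OF _ p, of "transpose_mat ?A"] by simp
  then have 2: "det ?B = signof p * det ?A"
    by (simp add: det_transpose[of _ n])
  have "signof p * (signof p * det ?A) = det ?A" by (simp add: sign_def)
  then show ?thesis using 1 2 by simp
qed

section \<open>Characteristic polynomials of tridiagonal matrices\<close>

lemma poly_char_poly_mat:
  "poly (char_poly (mat n n (\<lambda>(i, j). f i j))) x =
    det (mat n n (\<lambda>(i, j). (if i = j then x else 0) - f i j))" for x :: "'a :: field"
  by (subst char_poly_matrix[of _ n])
    (auto intro!: arg_cong[of _ _ det] eq_matI simp: char_matrix_def)

text \<open>Three-term recurrence of the leading principal minors. \<open>s i\<close> stands for the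
  product of the two entries beside the diagonal at \<open>i\<close>, so that square roots
  disappear.\<close>

fun tridiag_poly :: "(nat \<Rightarrow> 'a) \<Rightarrow> (nat \<Rightarrow> 'a) \<Rightarrow> nat \<Rightarrow> 'a :: comm_ring_1 poly" where
  "tridiag_poly a s 0 = 1"
| "tridiag_poly a s (Suc 0) = [:- a 0, 1:]"
| "tridiag_poly a s (Suc (Suc n)) = [:- a (Suc n), 1:] * tridiag_poly a s (Suc n) - [:s n:] * tridiag_poly a s n"

lemma tridiag_poly_cong:
  assumes "\<And>i. i < n \<Longrightarrow> a i = a' i" "\<And>i. Suc i < n \<Longrightarrow> s i = s' i"
  shows "tridiag_poly a s n = tridiag_poly a' s' n"
  using assms by (induction a s n rule: tridiag_poly.induct) auto

text \<open>Laplace expansion along the last row, followed by expansion of the minor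
  \<open>?B\<close> along its last column, where only \<open>b n\<close> can be nonzero.\<close>

lemma det_tridiagonal_step:
  fixes a b c :: "nat \<Rightarrow> 'a :: comm_ring_1"
  defines "M \<equiv> \<lambda>n. mat n n (\<lambda>(i, j). if i = j then a i else if j = Suc i then b i
    else if i = Suc j then c j else 0)"
  shows "det (M (Suc (Suc n))) = a (Suc n) * det (M (Suc n)) - b n * c n * det (M n)"
proof -
  let ?A = "M (Suc (Suc n))"
  let ?B = "mat_delete ?A (Suc n) n"
  have A: "?A \<in> carrier_mat (Suc (Suc n)) (Suc (Suc n))" by (simp add: M_def)
  have B: "?B \<in> carrier_mat (Suc n) (Suc n)" using mat_delete_carrier[OF A] by simp
  have dA: "mat_delete ?A (Suc n) (Suc n) = M (Suc n)"
    by (rule eq_matI) (auto simp: M_def mat_delete_def)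
  have dB: "mat_delete ?B n n = M n"
    by (rule eq_matI) (auto simp: M_def mat_delete_def)
  have "det ?B = (\<Sum>i<Suc n. ?B $$ (i, n) * cofactor ?B i n)"
    by (rule laplace_expansion_column[OF B]) simp
  also have "\<dots> = (\<Sum>i\<in>{n}. ?B $$ (i, n) * cofactor ?B i n)"
    by (rule sum.mono_neutral_right) (auto simp: M_def mat_delete_def)
  also have "\<dots> = b n * det (M n)"
    unfolding cofactor_def by (simp add: dB) (simp add: M_def mat_delete_def)
  finally have detB: "det ?B = b n * det (M n)" .
  have "det ?A = (\<Sum>j<Suc (Suc n). ?A $$ (Suc n, j) * cofactor ?A (Suc n) j)"
    by (rule laplace_expansion_row[OF A]) simp
  also have "\<dots> = (\<Sum>j\<in>{n, Suc n}. ?A $$ (Suc n, j) * cofactor ?A (Suc n) j)"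
    by (rule sum.mono_neutral_right) (auto simp: M_def)
  also have "\<dots> = a (Suc n) * det (M (Suc n)) - b n * c n * det (M n)"
    unfolding cofactor_def by (simp add: dA detB) (simp add: M_def)
  finally show ?thesis .
qed

lemma char_poly_tridiagonal:
  fixes a b c :: "nat \<Rightarrow> 'a :: comm_ring_1"
  shows "char_poly (mat n n (\<lambda>(i, j). if i = j then a i else if j = Suc i then b i
    else if i = Suc j then c j else 0)) = tridiag_poly a (\<lambda>i. b i * c i) n"
proof -
  define M where "M = (\<lambda>n. mat n n (\<lambda>(i, j). if i = j then [:- a i, 1:]
    else if j = Suc i then [:- b i:] else if i = Suc j then [:- c j:] else 0))"
  have "char_poly_matrix (mat n n (\<lambda>(i, j). if i = j then a i else if j = Suc i then b i
    else if i = Suc j then c j else 0)) = M n"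
    by (rule eq_matI) (auto simp: M_def char_poly_matrix_def)
  moreover have "det (M n) = tridiag_poly a (\<lambda>i. b i * c i) n"
  proof (induction n rule: induct_nat_012)
    case 0
    then show ?case by (simp add: M_def)
  next
    case 1
    show ?case by (subst det_single) (auto simp: M_def)
  next
    case (ge2 n)
    then show ?case
      using det_tridiagonal_step[of n "\<lambda>i. [:- a i, 1:]" "\<lambda>i. [:- b i:]" "\<lambda>i. [:- c i:]"]
      by (simp add: M_def mult.commute)
  qed
  ultimately show ?thesis by (simp add: char_poly_def)
qed

section \<open>Rooted trees and generalized Bethe trees\<close>

lemma walk_Suc_right: "walk E (Suc m) u v \<longleftrightarrow> (\<exists>w. walk E m u w \<and> E w v)"
proof (induction m arbitrary: u)
  case (Suc m)
  show ?case using Suc.IH by (metis walk.simps(2))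
qed auto

locale rooted_tree =
  fixes N :: nat and E :: "nat \<Rightarrow> nat \<Rightarrow> bool"
  assumes tree: "is_tree N E"
begin

lemma edgeD: "E u v \<Longrightarrow> u < N \<and> v < N \<and> u \<noteq> v \<and> E v u"
  using tree unfolding is_tree_def connected_graph_def simple_graph_def by blast

lemma N_pos: "0 < N"
  using tree unfolding is_tree_def connected_graph_def by simp

abbreviation "dep \<equiv> gdist E 0"

lemma walk_dep: "v < N \<Longrightarrow> walk E (dep v) 0 v"
  using tree N_pos unfolding is_tree_def connected_graph_def gdist_def
  by (metis LeastI_ex)

lemma dep_le: "walk E m 0 v \<Longrightarrow> dep v \<le> m"
  unfolding gdist_def by (rule Least_le)

lemma dep_root: "dep 0 = 0"
  using dep_le[of 0 0] by simp

lemma dep_eq_0: "v < N \<Longrightarrow> dep v = 0 \<longleftrightarrow> v = 0"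
  using walk_dep[of v] dep_root by (metis walk.simps(1))

definition par :: "nat \<Rightarrow> nat" where
  "par v = (SOME w. E w v \<and> Suc (dep w) = dep v)"

text \<open>The last vertex but one of a shortest walk from the root has depth exactly one less, so
  the choice in \<open>par\<close> has a witness.\<close>

lemma par: assumes "v < N" "v \<noteq> 0" shows "E (par v) v" "Suc (dep (par v)) = dep v"
proof -
  obtain m where m: "dep v = Suc m" using dep_eq_0[OF assms(1)] assms(2) not0_implies_Suc by blast
  then obtain w where w: "walk E m 0 w" "E w v"
    using walk_dep[OF assms(1)] walk_Suc_right[of E m 0 v] by auto
  have "Suc (dep w) = dep v"
  proof (rule antisym)
    show "Suc (dep w) \<le> dep v" using dep_le[OF w(1)] m by simp
    have "walk E (dep w) 0 w" using walk_dep edgeD[OF w(2)] by blast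
    then show "dep v \<le> Suc (dep w)" using w(2) by (intro dep_le) (auto simp: walk_Suc_right simp del: walk.simps)
  qed
  with w(2) have "\<exists>w. E w v \<and> Suc (dep w) = dep v" by blast
  from someI_ex[OF this] show "E (par v) v" "Suc (dep (par v)) = dep v"
    unfolding par_def by auto
qed

lemma par_less: "v < N \<Longrightarrow> v \<noteq> 0 \<Longrightarrow> par v < N"
  using par(1) edgeD by blast

text \<open>The edges joining a vertex to its parent are pairwise different, and there are as many
  of them as there are edges.\<close>
lemma edge_par:
  assumes e: "E u v"
  shows "v \<noteq> 0 \<and> par v = u \<or> u \<noteq> 0 \<and> par u = v"
proof -
  define f where "f v = (min v (par v), max v (par v))" for v
  let ?D = "{(u, v). u < v \<and> v < N \<and> E u v}"
  \<comment> \<open>Distinct vertices with the same image would be parents of each other, which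
    their depths exclude.\<close>
  have inj: "inj_on f {1..<N}"
  proof (rule inj_onI)
    fix v w assume v: "v \<in> {1..<N}" and w: "w \<in> {1..<N}" and "f v = f w"
    then have "v = w \<or> v = par w \<and> w = par v" unfolding f_def by (auto simp: min_def max_def split: if_splits)
    then show "v = w" using par(2)[of v] par(2)[of w] v w by auto
  qed
  have fin: "finite ?D" by (rule finite_subset[of _ "{..<N} \<times> {..<N}"]) auto
  have sub: "f ` {1..<N} \<subseteq> ?D"
  proof
    fix e assume "e \<in> f ` {1..<N}"
    then obtain v where v: "v < N" "v \<noteq> 0" "e = f v" by auto
    with par(1)[OF v(1,2)] edgeD[OF par(1)[OF v(1,2)]] show "e \<in> ?D"
      unfolding f_def by (auto simp: min_def max_def)
  qed
  have "card (f ` {1..<N}) = card ?D"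
    using card_image[OF inj] tree unfolding is_tree_def by simp
  then have eq: "f ` {1..<N} = ?D" using card_subset_eq[OF fin sub] by simp
  have "(min u v, max u v) \<in> ?D" using e edgeD[OF e] by (auto simp: min_def max_def)
  then obtain w where w: "w \<in> {1..<N}" "f w = (min u v, max u v)" unfolding eq[symmetric] by auto
  then have "w = u \<and> par w = v \<or> w = v \<and> par w = u"
    unfolding f_def by (auto simp: min_def max_def split: if_splits)
  then show ?thesis using w(1) by auto
qed

lemma edge_iff:
  assumes "u < N" "v < N"
  shows "E u v \<longleftrightarrow> v \<noteq> 0 \<and> par v = u \<or> u \<noteq> 0 \<and> par u = v"
  using edge_par[of u v] par(1)[of u] par(1)[of v] assms edgeD by blast

definition ch :: "nat \<Rightarrow> nat set" where
  "ch u = {v. v < N \<and> v \<noteq> 0 \<and> par v = u}"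

lemma finite_ch [simp]: "finite (ch u)"
  by (rule finite_subset[of _ "{..<N}"]) (auto simp: ch_def)

lemma gdeg_ch:
  assumes "u < N"
  shows "gdeg N E u = card (ch u) + (if u = 0 then 0 else 1)"
proof -
  have "{w. w < N \<and> E u w} = ch u \<union> (if u = 0 then {} else {par u})"
    using edge_iff[OF assms] par_less[OF assms] by (auto simp: ch_def)
  moreover have "par u \<notin> ch u" if "u \<noteq> 0"
    using par(2)[OF assms that] par(2)[of "par u"] by (auto simp: ch_def)
  ultimately show ?thesis unfolding gdeg_def by auto
qed

lemma level_par: "v < N \<Longrightarrow> v \<noteq> 0 \<Longrightarrow> level E v = Suc (level E (par v))"
  using par(2) by (simp add: level_def)

lemma level_eq_1: "v < N \<Longrightarrow> level E v = 1 \<longleftrightarrow> v = 0"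
  using dep_eq_0 by (simp add: level_def)

end

section \<open>Levels, degrees and level sizes of generalized Bethe trees\<close>

locale bethe_tree = rooted_tree N E for N E +
  fixes k :: nat
  assumes bethe: "gen_bethe_tree N E k" and k2: "2 \<le> k"
begin

lemma level_bounds: "v < N \<Longrightarrow> 1 \<le> level E v \<and> level E v \<le> k"
  using bethe unfolding gen_bethe_tree_def by (auto simp: level_def)

lemma gdeg_level: "u < N \<Longrightarrow> v < N \<Longrightarrow> level E u = level E v \<Longrightarrow> gdeg N E u = gdeg N E v"
  using bethe unfolding gen_bethe_tree_def by blast

text \<open>Some vertex attains the maximal level \<open>k\<close>; its ancestors cover all smaller
  levels.\<close>

lemma level_nonempty:
  assumes "1 \<le> l" "l \<le> k"
  shows "\<exists>v<N. level E v = l"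
  using assms(2,1)
proof (induction l rule: inc_induct)
  case base
  have "Max (level E ` {0..<N}) \<in> level E ` {0..<N}" using N_pos by (intro Max_in) auto
  then show ?case using bethe unfolding gen_bethe_tree_def by auto
next
  case (step l)
  then obtain v where v: "v < N" "level E v = Suc l" by auto
  then have "v \<noteq> 0" using level_eq_1[of v] step by auto
  then show ?case using level_par[OF v(1)] par_less[OF v(1)] v(2) by auto
qed

text \<open>\<open>Suc (k - level E u)\<close> is the index of the level of \<open>u\<close>,
  counted from the deepest level. Equal degrees on a level make the choice in \<open>bethe_d\<close>
  immaterial.\<close>

lemma bethe_d_eq: 
  assumes "u < N"
  shows "bethe_d N E k (Suc (k - level E u)) = gdeg N E u"
proof -
  have l: "k - Suc (k - level E u) + 1 = level E u" using level_bounds[OF assms] by auto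
  have "\<exists>v. v < N \<and> level E v = level E u" using assms by auto
  from someI_ex[OF this] show ?thesis
    unfolding bethe_d_def l using gdeg_level assms by blast
qed

lemma card_ch_eq:
  "u < N \<Longrightarrow> u \<noteq> 0 \<Longrightarrow> real (card (ch u)) = real (bethe_d N E k (Suc (k - level E u))) - 1"
  using gdeg_ch[of u] bethe_d_eq[of u] by simp

lemma card_ch_root: "card (ch 0) = bethe_d N E k k"
  using gdeg_ch[of 0] bethe_d_eq[of 0] level_eq_1[of 0] N_pos k2 by simp

lemma ch_leaf: "level E u = k \<Longrightarrow> ch u = {}"
  using level_par level_bounds unfolding ch_def by fastforce

text \<open>The next level contains a vertex; its parent has the level of \<open>u\<close>, hence
  the degree of \<open>u\<close> and as many children.\<close>

lemma ch_nonempty: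
  assumes u: "u < N" "level E u < k"
  shows "ch u \<noteq> {}"
proof -
  obtain v where v: "v < N" "level E v = Suc (level E u)"
    using level_nonempty[of "Suc (level E u)"] u by auto
  then have v0: "v \<noteq> 0" using level_eq_1[of v] level_bounds[OF u(1)] by auto
  let ?w = "par v"
  have w: "?w < N" "level E ?w = level E u" "v \<in> ch ?w"
    using level_par[OF v(1) v0] par_less[OF v(1) v0] v v0 by (auto simp: ch_def)
  have "?w = 0 \<longleftrightarrow> u = 0" using level_eq_1 w(1,2) u(1) by metis
  then have "card (ch u) = card (ch ?w)"
    using gdeg_ch[OF u(1)] gdeg_ch[OF w(1)] gdeg_level[OF u(1) w(1)] w(2) by (auto split: if_splits)
  moreover have "card (ch ?w) > 0" using w(3) by (auto simp: card_gt_0_iff)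
  ultimately show ?thesis by auto
qed

lemma bethe_d_ge_2:
  assumes "2 \<le> j" "j < k"
  shows "2 \<le> bethe_d N E k j"
proof -
  obtain v where v: "v < N" "level E v = k - j + 1"
    using level_nonempty[of "k - j + 1"] assms by (auto simp: Suc_le_eq)
  then have "v \<noteq> 0" using level_eq_1[OF v(1)] assms by auto
  moreover have "card (ch v) > 0" using ch_nonempty[OF v(1)] v assms by (auto simp: card_gt_0_iff)
  moreover have "Suc (k - level E v) = j" using v assms by auto
  ultimately show ?thesis using bethe_d_eq[OF v(1)] gdeg_ch[OF v(1)] by simp
qed

lemma bethe_d_root: "1 \<le> bethe_d N E k k"
proof -
  have "ch 0 \<noteq> {}" using ch_nonempty[of 0] N_pos level_eq_1[of 0] k2 by auto
  then show ?thesis unfolding card_ch_root[symmetric] by (simp add: Suc_le_eq card_gt_0_iff)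
qed

lemma bethe_n_root: "bethe_n N E k k = 1"
proof -
  have "{v. v < N \<and> level E v = k - k + 1} = {0}" using level_eq_1 N_pos by auto
  then show ?thesis unfolding bethe_n_def by simp
qed

text \<open>Every vertex above the deepest level has a child, so \<open>par\<close> maps each level
  onto the one above. Hence the natural-number differences in the multiplicities are never
  truncated.\<close>

lemma bethe_n_antimono:
  assumes "1 \<le> j" "j < k"
  shows "bethe_n N E k (Suc j) \<le> bethe_n N E k j"
proof -
  let ?A = "{v. v < N \<and> level E v = k - j + 1}"
  let ?B = "{v. v < N \<and> level E v = k - Suc j + 1}"
  have "?B \<subseteq> par ` ?A"
  proof
    fix u assume u: "u \<in> ?B"
    then have "ch u \<noteq> {}" using ch_nonempty[of u] assms by auto
    then obtain v where "v < N" "v \<noteq> 0" "par v = u" unfolding ch_def by auto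
    then show "u \<in> par ` ?A" using u level_par[of v] assms by auto
  qed
  then show ?thesis unfolding bethe_n_def by (intro surj_card_le) auto
qed

end

section \<open>Roots of tridiagonal characteristic polynomials\<close>

text \<open>The recurrence is realised by the tridiagonal matrix with \<open>s\<close> above and
  \<open>1\<close> below the diagonal, and characteristic polynomials are monic.\<close>

lemma degree_tridiag_poly:
  fixes a s :: "nat \<Rightarrow> real"
  shows "degree (tridiag_poly a s n) = n" "lead_coeff (tridiag_poly a s n) = 1"
proof -
  let ?A = "mat n n (\<lambda>(i, j). if i = j then a i else if j = Suc i then s i
    else if i = Suc j then 1 else 0)"
  have "char_poly ?A = tridiag_poly a s n" using char_poly_tridiagonal[of n a s "\<lambda>_. 1"] by simp
  moreover have "degree (char_poly ?A) = n \<and> coeff (char_poly ?A) n = 1"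
    by (rule degree_monic_char_poly) simp
  ultimately show "degree (tridiag_poly a s n) = n" "lead_coeff (tridiag_poly a s n) = 1" by auto
qed

lemma map_poly_tridiag:
  fixes a s :: "nat \<Rightarrow> real"
  shows "map_poly complex_of_real (tridiag_poly a s n) = tridiag_poly (\<lambda>i. of_real (a i)) (\<lambda>i. of_real (s i)) n"
proof (induction a s n rule: tridiag_poly.induct)
  case (3 a s n)
  interpret map_poly_comm_ring_hom complex_of_real ..
  show ?case by (simp add: hom_distribs 3 del: mult_pCons_left)
qed (simp_all add: map_poly_pCons)

text \<open>By the intermediate value theorem a root follows every point where \<open>p\<close> is
  negative. So beyond the largest of the finitely many roots no value is negative or zero.\<close>

lemma largest_root_exists:
  fixes p :: "real poly"
  assumes "lead_coeff p > 0" "poly p a < 0"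
  obtains b where "a < b" "poly p b = 0" "\<And>x. b < x \<Longrightarrow> poly p x > 0"
proof -
  obtain m where m: "\<And>x. m \<le> x \<Longrightarrow> lead_coeff p \<le> poly p x"
    using poly_pinfty_gt_lc[OF assms(1)] by auto
  have p0: "p \<noteq> 0" using assms(1) by auto
  have root: "\<exists>z>y. poly p z = 0" if "poly p y < 0" for y
    using poly_IVT_pos[of y "max m (y + 1)" p] that m[of "max m (y + 1)"] assms(1) by fastforce
  let ?Z = "{z. poly p z = 0}"
  have fin: "finite ?Z" using p0 by (rule poly_roots_finite)
  obtain z where z: "z > a" "poly p z = 0" using root[OF assms(2)] by auto
  let ?b = "Max ?Z"
  have ne: "?Z \<noteq> {}" using z by auto
  have "poly p ?b = 0" using Max_in[OF fin ne] by simp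
  moreover have "a < ?b" using z Max_ge[OF fin, of z] by simp
  moreover have "poly p x > 0" if "?b < x" for x
  proof (rule ccontr)
    assume "\<not> ?thesis"
    then have "\<exists>z\<ge>x. poly p z = 0" using root[of x] by (cases "poly p x = 0") (auto simp: less_eq_real_def)
    then show False using Max_ge[OF fin] that by force
  qed
  ultimately show ?thesis using that by blast
qed

text \<open>At the largest root of \<open>tridiag_poly a s n\<close> the polynomial \<open>tridiag_poly a s (n + 1)\<close> is negative by
  the recurrence, so its largest root lies further to the right.\<close>
lemma tridiag_poly_top_root:
  fixes a s :: "nat \<Rightarrow> real"
  assumes "\<And>i. i < n \<Longrightarrow> s i > 0"
  shows "\<exists>l. poly (tridiag_poly a s (Suc n)) l = 0 \<and> (\<forall>j\<le>n. poly (tridiag_poly a s j) l > 0) \<and>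
    (\<forall>x>l. \<forall>j\<le>Suc n. poly (tridiag_poly a s j) x > 0)"
  using assms
proof (induction n)
  case 0
  show ?case by (rule exI[of _ "a 0"]) (auto simp: le_Suc_eq)
next
  case (Suc n)
  then obtain l where l: "poly (tridiag_poly a s (Suc n)) l = 0" "\<And>j. j \<le> n \<Longrightarrow> poly (tridiag_poly a s j) l > 0"
    "\<And>x j. x > l \<Longrightarrow> j \<le> Suc n \<Longrightarrow> poly (tridiag_poly a s j) x > 0" by auto
  have neg: "poly (tridiag_poly a s (Suc (Suc n))) l < 0" using l(1) l(2)[of n] Suc.prems[of n] by simp
  have "lead_coeff (tridiag_poly a s (Suc (Suc n))) > 0" unfolding degree_tridiag_poly(2) by simp
  from largest_root_exists[OF this neg] obtain b where
    b: "l < b" "poly (tridiag_poly a s (Suc (Suc n))) b = 0"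
    "\<And>x. b < x \<Longrightarrow> poly (tridiag_poly a s (Suc (Suc n))) x > 0" by blast
  show ?case
  proof (intro exI[of _ b] conjI allI impI)
    fix x j assume "b < x" "j \<le> Suc (Suc n)"
    then show "poly (tridiag_poly a s j) x > 0" using l(3)[of x j] b by (cases "j = Suc (Suc n)") auto
  qed (use l(3) b in auto)
qed

text \<open>The pivot \<open>Q (j + 1) / Q j\<close> at \<open>z\<close> is at least the pivot \<open>P (j + 1) / P j\<close> at
  \<open>cmod z\<close>, stated without division; this replaces the Perron-Frobenius theorem.\<close>
lemma tridiag_poly_norm_bound:
  fixes a s :: "nat \<Rightarrow> real" and c :: "nat \<Rightarrow> complex"
  assumes c: "\<And>i. i < n \<Longrightarrow> cmod (c i) \<le> a i"
    and s: "\<And>i. Suc i < n \<Longrightarrow> s i \<ge> 0"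
    and pos: "\<And>j. j \<le> n \<Longrightarrow> poly (tridiag_poly a s j) (cmod z) > 0"
    and j: "j < n"
  defines "P \<equiv> \<lambda>j. poly (tridiag_poly a s j) (cmod z)"
    and "Q \<equiv> \<lambda>j. cmod (poly (tridiag_poly c (\<lambda>i. of_real (s i)) j) z)"
  shows "P (Suc j) * Q j \<le> Q (Suc j) * P j \<and> Q (Suc j) > 0"
  using j
proof (induction j)
  case 0
  have "cmod z - a 0 \<le> cmod (z - c 0)"
    using c[OF 0] norm_triangle_ineq2[of z "c 0"] by simp
  moreover have "cmod z - a 0 > 0" using pos[of 1] 0 by simp
  ultimately show ?case by (auto simp: P_def Q_def)
next
  case (Suc j)
  have IH: "P (Suc j) * Q j \<le> Q (Suc j) * P j" "Q (Suc j) > 0" using Suc by auto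
  have P: "P (Suc j) > 0" "P (Suc (Suc j)) > 0" using pos Suc.prems by (auto simp: P_def simp del: tridiag_poly.simps)
  have P2: "P (Suc (Suc j)) = (cmod z - a (Suc j)) * P (Suc j) - s j * P j"
    by (simp add: P_def algebra_simps)
  have "Q (Suc (Suc j)) =
      cmod ((z - c (Suc j)) * poly (tridiag_poly c (\<lambda>i. of_real (s i)) (Suc j)) z
        - of_real (s j) * poly (tridiag_poly c (\<lambda>i. of_real (s i)) j) z)"
    by (simp add: Q_def algebra_simps)
  also have "\<dots> \<ge> cmod (z - c (Suc j)) * Q (Suc j) - s j * Q j"
    using norm_triangle_ineq2[of "(z - c (Suc j)) * poly (tridiag_poly c (\<lambda>i. of_real (s i)) (Suc j)) z"
        "of_real (s j) * poly (tridiag_poly c (\<lambda>i. of_real (s i)) j) z"] s[of j] Suc.prems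
    unfolding norm_mult Q_def by simp
  finally have q: "Q (Suc (Suc j)) \<ge> cmod (z - c (Suc j)) * Q (Suc j) - s j * Q j" .
  have "cmod z - a (Suc j) \<le> cmod (z - c (Suc j))"
    using c[OF Suc.prems] norm_triangle_ineq2[of z "c (Suc j)"] by simp
  then have "(cmod z - a (Suc j)) * Q (Suc j) \<le> cmod (z - c (Suc j)) * Q (Suc j)"
    using IH(2) by (intro mult_right_mono) auto
  with q have "(cmod z - a (Suc j)) * Q (Suc j) - s j * Q j \<le> Q (Suc (Suc j))" by linarith
  then have "((cmod z - a (Suc j)) * Q (Suc j) - s j * Q j) * P (Suc j) \<le> Q (Suc (Suc j)) * P (Suc j)"
    using P by (intro mult_right_mono) auto
  \<comment> \<open>The induction hypothesis trades \<open>s j * Q j * P (Suc j)\<close> for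
    \<open>s j * P j * Q (Suc j)\<close>, the subtracted term of \<open>P2\<close> times
    \<open>Q (Suc j)\<close>.\<close>
  moreover have "s j * (P (Suc j) * Q j) \<le> s j * (Q (Suc j) * P j)"
    using IH(1) s[of j] Suc.prems by (intro mult_left_mono) auto
  ultimately have 1: "P (Suc (Suc j)) * Q (Suc j) \<le> Q (Suc (Suc j)) * P (Suc j)"
    unfolding P2 by (simp add: algebra_simps)
  have "0 < P (Suc (Suc j)) * Q (Suc j)" using P IH(2) by simp
  with 1 have "0 < Q (Suc (Suc j)) * P (Suc j)" by linarith
  then have "Q (Suc (Suc j)) > 0" using P(1) by (simp add: zero_less_mult_iff)
  with 1 show ?case by simp
qed

text \<open>This serves to exclude eigenvalues of modulus above the candidate spectral
  radius.\<close>

lemma tridiag_poly_nonzero_outside: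
  fixes a s :: "nat \<Rightarrow> real" and c :: "nat \<Rightarrow> complex"
  assumes c: "\<And>i. i < n \<Longrightarrow> cmod (c i) \<le> a i"
    and s: "\<And>i. Suc i < n \<Longrightarrow> s i \<ge> 0"
    and pos: "\<And>j. j \<le> n \<Longrightarrow> poly (tridiag_poly a s j) (cmod z) > 0"
    and j: "j \<le> n"
  shows "poly (tridiag_poly c (\<lambda>i. of_real (s i)) j) z \<noteq> 0"
  using tridiag_poly_norm_bound[of n c a s z "j - 1"] assms by (cases j) auto

section \<open>Elimination on rooted products\<close>

lemma mult_add_less:
  fixes j v r N :: nat
  assumes "j < r" "v < N"
  shows "j * N + v < r * N"
proof -
  have "j * N + v < Suc j * N" using assms by simp
  also have "\<dots> \<le> r * N" using assms by (intro mult_right_mono) auto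
  finally show ?thesis .
qed

text \<open>The indices fall into \<open>m\<close> blocks of length \<open>r\<close>. In the
  elimination a block collects one tree vertex over all copies.\<close>

lemma prod_div:
  fixes h :: "nat \<Rightarrow> 'a :: comm_monoid_mult"
  assumes "r > 0"
  shows "(\<Prod>i<m * r. h (i div r)) = (\<Prod>u<m. h u) ^ r"
proof (induction m)
  case (Suc m)
  have "(\<Prod>i<Suc m * r. h (i div r)) = (\<Prod>i\<in>{..<m * r} \<union> {m * r..<m * r + r}. h (i div r))"
    by (rule prod.cong) auto
  also have "\<dots> = (\<Prod>i<m * r. h (i div r)) * (\<Prod>i = m * r..<m * r + r. h (i div r))"
    by (rule prod.union_disjoint) auto
  also have "(\<Prod>i = m * r..<m * r + r. h (i div r)) = (\<Prod>i = m * r..<m * r + r. h m)"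
    by (intro prod.cong refl arg_cong[of _ _ h] div_nat_eqI) (auto simp: algebra_simps)
  finally show ?case using Suc by (simp add: power_mult_distrib mult.commute)
qed auto

text \<open>Neighbours lie in the same copy or, for a root, are roots of copies adjacent in
  \<open>ER\<close>. The two kinds are disjoint because \<open>ER\<close> has no loops.\<close>

lemma gdeg_rooted_product:
  assumes ER: "simple_graph r ER" and E: "simple_graph N E" and i: "i < r" and u: "u < N"
  shows "gdeg (r * N) (rooted_product r ER N E) (i * N + u) =
    gdeg N E u + (if u = 0 then gdeg r ER i else 0)"
proof -
  let ?A = "(\<lambda>v. i * N + v) ` {v. v < N \<and> E u v}"
  let ?B = "(\<lambda>j. j * N) ` {j. j < r \<and> ER i j \<and> u = 0}"
  have "{q. q < r * N \<and> rooted_product r ER N E (i * N + u) q} = ?A \<union> ?B"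
  proof (intro equalityI subsetI)
    fix q assume "q \<in> {q. q < r * N \<and> rooted_product r ER N E (i * N + u) q}"
    then have q: "q < r * N" "q div N = i \<and> E u (q mod N) \<or> u = 0 \<and> q mod N = 0 \<and> ER i (q div N)"
      using u by (auto simp: rooted_product_def)
    from q(2) show "q \<in> ?A \<union> ?B"
    proof
      assume *: "q div N = i \<and> E u (q mod N)"
      then have "q = i * N + q mod N" using div_mult_mod_eq[of q N] by simp
      moreover have "q mod N < N" using u by simp
      ultimately show ?thesis using * by blast
    next
      assume *: "u = 0 \<and> q mod N = 0 \<and> ER i (q div N)"
      then have "q = q div N * N" using div_mult_mod_eq[of q N] by simp
      moreover have "q div N < r" using q(1) by (simp add: less_mult_imp_div_less)
      ultimately show ?thesis using * by blast
    qed
  next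
    fix q assume "q \<in> ?A \<union> ?B"
    then show "q \<in> {q. q < r * N \<and> rooted_product r ER N E (i * N + u) q}"
      using mult_add_less[OF i] mult_add_less[of _ r 0] i u by (auto simp: rooted_product_def)
  qed
  moreover have "?A \<inter> ?B = {}"
  proof -
    have False if "v < N" "E u v" "ER i j" "u = 0" "i * N + v = j * N" for v j
    proof -
      have "(i * N + v) div N = i" "(j * N) div N = j" using that(1) u by auto
      then have "i = j" using that(5) by simp
      then show False using that ER unfolding simple_graph_def by blast
    qed
    then show ?thesis by auto
  qed
  moreover have "card ?A = gdeg N E u" unfolding gdeg_def by (rule card_image) (auto simp: inj_on_def)
  moreover have "card ?B = (if u = 0 then gdeg r ER i else 0)"
    unfolding gdeg_def using u by (subst card_image) (auto simp: inj_on_def)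
  ultimately show ?thesis unfolding gdeg_def[of "r * N"] by (simp add: card_Un_disjoint)
qed

context rooted_tree
begin

lemma simple: "simple_graph N E"
  using tree unfolding is_tree_def connected_graph_def by simp

lemma not_own_child: "u \<notin> ch u" 
  using par(2)[of u] by (auto simp: ch_def)

text \<open>Gaussian elimination from the leaves towards the roots: \<open>p u\<close> is the pivot of the vertex
  \<open>u\<close> of each copy of the tree, and the elimination leaves \<open>c * I - A_alpha \<alpha> r ER\<close> on the
  roots.\<close>
lemma char_poly_rooted_product:
  fixes p :: "nat \<Rightarrow> real"
  assumes ER: "simple_graph r ER" and r: "r > 0"
    and p0: "\<And>u. u < N \<Longrightarrow> u \<noteq> 0 \<Longrightarrow> p u \<noteq> 0"
    and p: "\<And>u. u < N \<Longrightarrow> u \<noteq> 0 \<Longrightarrow>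
      x - \<alpha> * real (gdeg N E u) = p u + (\<Sum>w\<in>ch u. (1 - \<alpha>)\<^sup>2 / p w)"
    and c: "x - \<alpha> * real (gdeg N E 0) = c + (\<Sum>w\<in>ch 0. (1 - \<alpha>)\<^sup>2 / p w)"
  shows "poly (char_poly (A_alpha \<alpha> (r * N) (rooted_product r ER N E))) x =
    poly (char_poly (A_alpha \<alpha> r ER)) c * (\<Prod>u = 1..<N. p u) ^ r"
proof -
  let ?n = "r * N"
  define \<beta> where "\<beta> = 1 - \<alpha>"
  define AR where "AR i j = (if i = j then \<alpha> * real (gdeg r ER i) else if ER i j then \<beta> else 0)" for i j
  define AG where "AG i j = (if i = j then \<alpha> * real (gdeg ?n (rooted_product r ER N E) i)
    else if rooted_product r ER N E i j then \<beta> else 0)" for i j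
  define f where "f i j = (if i = j then x else 0) - AG i j" for i j
  \<comment> \<open>Index \<open>u * r + i\<close> denotes vertex \<open>u\<close> of copy
    \<open>i\<close>, so that the \<open>r\<close> roots come first and form a block;
    \<open>\<pi>\<close> translates to the numbering \<open>i * N + u\<close> of the rooted
    product.\<close>
  define \<pi> where "\<pi> q = (if q < ?n then (q mod r) * N + q div r else q)" for q
  have bd: "q div r < N" "q mod r < r" if "q < ?n" for q
    using that r by (auto simp: less_mult_imp_div_less mult.commute)
  have \<pi>_divmod: "\<pi> q div N = q mod r" "\<pi> q mod N = q div r" "\<pi> q < ?n" if "q < ?n" for q
    using that bd[OF that] by (auto simp: \<pi>_def mult_add_less)
  have \<pi>_inj: "inj_on \<pi> {0..<?n}"
    by (rule inj_onI) (metis \<pi>_divmod(1,2) atLeastLessThan_iff div_mult_mod_eq)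
  have "\<pi> ` {0..<?n} = {0..<?n}"
    by (rule endo_inj_surj) (use \<pi>_inj \<pi>_divmod in auto)
  then have "\<pi> permutes {0..<?n}"
    using \<pi>_inj by (intro bij_imp_permutes) (auto simp: bij_betw_def \<pi>_def)
  then have perm: "det (mat ?n ?n (\<lambda>(i, j). f i j)) = det (mat ?n ?n (\<lambda>(i, j). f (\<pi> i) (\<pi> j)))"
    by (rule det_permute_both[symmetric])
  define C where "C i j = (if i = j then c else 0) - AR i j" for i j
  \<comment> \<open>The matrix after elimination: a root row keeps only the root block
    \<open>C\<close>, any other row only its pivot and the entry in the column of its
    parent.\<close>
  define g where "g q q' = (if q div r = 0 then (if q' div r = 0 then C (q mod r) (q' mod r) else 0)
    else if q = q' then p (q div r)
    else if q mod r = q' mod r \<and> q' div r = par (q div r) then - \<beta> else 0)" for q q'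
  \<comment> \<open>Multipliers that undo the elimination: adding \<open>- \<beta> / p w\<close>
    times the row of each child \<open>w\<close> restores \<open>- \<beta>\<close> in the column of
    \<open>w\<close> and adds \<open>\<beta>\<^sup>2 / p w\<close> on the diagonal.\<close>
  define cc where "cc q q' = (if q mod r = q' mod r \<and> q' div r \<in> ch (q div r)
    then - \<beta> / p (q' div r) else 0)" for q q'
  have fg: "f (\<pi> q) (\<pi> q') = g q q' + (\<Sum>q''<?n. cc q q'' * g q'' q')"
    if q: "q < ?n" and q': "q' < ?n" for q q'
  proof -
    define u i v j where uv: "u = q div r" "i = q mod r" "v = q' div r" "j = q' mod r"
    have b: "u < N" "i < r" "v < N" "j < r" using bd q q' by (auto simp: uv)
    have eq: "q = q' \<longleftrightarrow> u = v \<and> i = j" unfolding uv by (metis div_mult_mod_eq)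
    have \<pi>q: "\<pi> q = i * N + u" using q by (simp add: \<pi>_def uv)
    have \<pi>eq: "\<pi> q = \<pi> q' \<longleftrightarrow> q = q'" using inj_onD[OF \<pi>_inj] q q' by auto
    have rp: "rooted_product r ER N E (\<pi> q) (\<pi> q') \<longleftrightarrow> i = j \<and> E u v \<or> u = 0 \<and> v = 0 \<and> ER i j"
      unfolding rooted_product_def using \<pi>_divmod[OF q] \<pi>_divmod[OF q'] by (simp add: uv)
    have F: "f (\<pi> q) (\<pi> q') = (if u = v \<and> i = j then x - \<alpha> * real (gdeg N E u + (if u = 0 then gdeg r ER i else 0))
      else if i = j \<and> E u v \<or> u = 0 \<and> v = 0 \<and> ER i j then - \<beta> else 0)"
      unfolding f_def AG_def \<pi>eq rp eq
      using gdeg_rooted_product[OF ER simple b(2,1)] by (auto simp: \<pi>q)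
    have "(\<Sum>q''<?n. cc q q'' * g q'' q') = (\<Sum>q''\<in>(\<lambda>w. w * r + i) ` ch u. cc q q'' * g q'' q')"
    proof (rule sum.mono_neutral_right)
      show "(\<lambda>w. w * r + i) ` ch u \<subseteq> {..<?n}"
      proof
        fix y assume "y \<in> (\<lambda>w. w * r + i) ` ch u"
        then obtain w where w: "w < N" "y = w * r + i" by (auto simp: ch_def)
        then show "y \<in> {..<?n}" using mult_add_less[OF w(1) b(2)] by (simp add: mult.commute)
      qed
      show "\<forall>q''\<in>{..<?n} - (\<lambda>w. w * r + i) ` ch u. cc q q'' * g q'' q' = 0"
      proof
        fix y assume y: "y \<in> {..<?n} - (\<lambda>w. w * r + i) ` ch u"
        then have "\<not> (i = y mod r \<and> y div r \<in> ch u)"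
          using div_mult_mod_eq[of y r] by (metis DiffE image_eqI)
        then show "cc q y * g y q' = 0" unfolding cc_def by (auto simp: uv)
      qed
    qed auto
    also have "\<dots> = (\<Sum>w\<in>ch u. cc q (w * r + i) * g (w * r + i) q')"
      by (subst sum.reindex) (use r in \<open>auto simp: inj_on_def\<close>)
    also have "\<dots> = (\<Sum>w\<in>ch u. if i \<noteq> j then 0 else (if w = v then - \<beta> else 0) + (if u = v then \<beta>\<^sup>2 / p w else 0))"
    proof (rule sum.cong[OF refl])
      fix w assume w: "w \<in> ch u"
      then have w': "w < N" "w \<noteq> 0" "par w = u" by (auto simp: ch_def)
      have dm: "(w * r + i) div r = w" "(w * r + i) mod r = i" using b by auto
      have eq': "w * r + i = q' \<longleftrightarrow> w = v \<and> i = j"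
        using dm unfolding uv by (metis div_mult_mod_eq)
      have "cc q (w * r + i) = - \<beta> / p w" using w unfolding cc_def dm by (simp add: uv)
      moreover have "g (w * r + i) q' = (if w = v \<and> i = j then p w else if i = j \<and> u = v then - \<beta> else 0)"
        unfolding g_def dm eq' using w' by (auto simp: uv)
      ultimately show "cc q (w * r + i) * g (w * r + i) q' =
        (if i \<noteq> j then 0 else (if w = v then - \<beta> else 0) + (if u = v then \<beta>\<^sup>2 / p w else 0))"
        using p0[OF w'(1,2)] w not_own_child[of u] by (auto simp: power2_eq_square)
    qed
    also have "\<dots> = (if i \<noteq> j then 0 else (if v \<in> ch u then - \<beta> else 0) + (if u = v then \<Sum>w\<in>ch u. \<beta>\<^sup>2 / p w else 0))"
      by (auto simp: sum.distrib)
    finally have S: "(\<Sum>q''<?n. cc q q'' * g q'' q') =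
      (if i \<noteq> j then 0 else (if v \<in> ch u then - \<beta> else 0) + (if u = v then \<Sum>w\<in>ch u. \<beta>\<^sup>2 / p w else 0))" .
    have G: "g q q' = (if u = 0 then (if v = 0 then C i j else 0)
      else if u = v \<and> i = j then p u else if i = j \<and> v = par u then - \<beta> else 0)"
      unfolding g_def eq by (simp add: uv)
    have edge: "E u v \<longleftrightarrow> v \<in> ch u \<or> u \<noteq> 0 \<and> v = par u"
      using edge_iff[OF b(1,3)] b(3) by (auto simp: ch_def)
    have excl: "par u \<notin> ch u" if "u \<noteq> 0"
      using par(2)[OF b(1) that] par(2)[of "par u"] by (auto simp: ch_def)
    have "0 \<notin> ch u" by (simp add: ch_def)
    moreover have "\<not> ER i i" using ER unfolding simple_graph_def by blast
    \<comment> \<open>On the diagonal this is the hypothesis on \<open>p u\<close>, or at a root the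
      one on \<open>c\<close>; there the degree in \<open>ER\<close> enters through
      \<open>AR\<close>.\<close>
    ultimately show ?thesis
      unfolding F S G edge using excl not_own_child[of u] p[OF b(1)] c
      by (cases "u = 0"; cases "i = j"; cases "u = v")
        (auto simp: C_def AR_def \<beta>_def algebra_simps)
  qed
  have L: "int (level E (q div r)) < int (level E (q' div r))" if "q < ?n" "q' < ?n" "cc q q' \<noteq> 0" for q q'
    using that level_par[of "q' div r"] by (auto simp: cc_def ch_def split: if_splits)
  have e1: "det (mat ?n ?n (\<lambda>(i, j). f (\<pi> i) (\<pi> j))) = det (mat ?n ?n (\<lambda>(i, j). g i j))"
    by (rule det_add_higher_rows[of ?n cc "\<lambda>q. int (level E (q div r))"]) (use L fg in auto)
  define m where "m = (N - 1) * r"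
  have n: "?n = r + m" using N_pos unfolding m_def by (cases N) auto
  have g_top: "g i j = (if j < r then C i j else 0)" if "i < r" for i j
    using that r by (simp add: g_def div_eq_0_iff)
  have "mat (r + m) (r + m) (\<lambda>(i, j). g i j) = four_block_mat (mat r r (\<lambda>(i, j). C i j)) (0\<^sub>m r m)
    (mat m r (\<lambda>(i, j). g (i + r) j)) (mat m m (\<lambda>(i, j). g (i + r) (j + r)))"
    by (rule eq_matI) (auto simp: g_top)
  then have e2: "det (mat ?n ?n (\<lambda>(i, j). g i j)) =
      det (mat r r (\<lambda>(i, j). C i j)) * det (mat m m (\<lambda>(i, j). g (i + r) (j + r)))"
    unfolding n by (simp add: det_four_block_mat_upper_right_zero[of _ r _ m])
  \<comment> \<open>Off the diagonal a nonzero entry leads from a vertex to its parent, which lowers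
    the level; hence the minus sign.\<close>
  have "det (mat m m (\<lambda>(i, j). g (i + r) (j + r))) = (\<Prod>i<m. g (i + r) (i + r))"
  proof (rule det_level_triangular[of m _ "\<lambda>i. - int (level E ((i + r) div r))"])
    fix i j assume ij: "i < m" "j < m" "i \<noteq> j" "g (i + r) (j + r) \<noteq> 0"
    have "(i + r) div r \<noteq> 0" using r by (simp add: div_eq_0_iff)
    moreover from this ij have "(j + r) div r = par ((i + r) div r)"
      by (auto simp: g_def split: if_splits)
    ultimately show "- int (level E ((i + r) div r)) < - int (level E ((j + r) div r))"
      using level_par[of "(i + r) div r"] bd(1)[of "i + r"] n ij by auto
  qed
  also have "\<dots> = (\<Prod>i<(N - 1) * r. p (Suc (i div r)))"
    unfolding m_def by (rule prod.cong) (use r in \<open>auto simp: g_def\<close>)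
  also have "\<dots> = (\<Prod>u<N - 1. p (Suc u)) ^ r" by (rule prod_div[OF r])
  also have "(\<Prod>u<N - 1. p (Suc u)) = (\<Prod>u = 1..<N. p u)"
    using prod.shift_bounds_Suc_ivl[of p 0 "N - 1"] N_pos by (simp add: atLeast0LessThan)
  finally have e3: "det (mat m m (\<lambda>(i, j). g (i + r) (j + r))) = (\<Prod>u = 1..<N. p u) ^ r" .
  have AG: "A_alpha \<alpha> ?n (rooted_product r ER N E) = mat ?n ?n (\<lambda>(i, j). AG i j)"
    by (rule eq_matI) (auto simp: A_alpha_def AG_def \<beta>_def)
  have AR: "A_alpha \<alpha> r ER = mat r r (\<lambda>(i, j). AR i j)"
    by (rule eq_matI) (auto simp: A_alpha_def AR_def \<beta>_def)
  have "poly (char_poly (A_alpha \<alpha> ?n (rooted_product r ER N E))) x = det (mat ?n ?n (\<lambda>(i, j). f i j))"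
    unfolding AG poly_char_poly_mat f_def ..
  moreover have "poly (char_poly (A_alpha \<alpha> r ER)) c = det (mat r r (\<lambda>(i, j). C i j))"
    unfolding AR poly_char_poly_mat C_def ..
  ultimately show ?thesis using perm e1 e2 e3 by simp
qed

end

section \<open>The characteristic polynomial\<close>

text \<open>The length condition says that \<open>p\<close> splits; its linear factors are divided
  off one by one. This turns the listed eigenvalues of \<open>R\<close> into a
  factorization.\<close>

lemma poly_eq_prod_list_proots:
  fixes p :: "'a :: idom poly"
  assumes "p \<noteq> 0" "mset xs = proots p" "length xs = degree p"
  shows "p = Polynomial.smult (lead_coeff p) (\<Prod>x\<leftarrow>xs. [:- x, 1:])"
  using assms
proof (induction xs arbitrary: p)
  case Nil
  then show ?case by (auto elim: degree_eq_zeroE)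
next
  case (Cons x xs)
  have "x \<in># proots p" using Cons.prems(2) by (metis list.set_intros(1) set_mset_mset)
  then have "poly p x = 0" using Cons.prems(1) by simp
  then obtain q where q: "p = [:- x, 1:] * q" unfolding poly_eq_0_iff_dvd by auto
  then have q0: "q \<noteq> 0" using Cons.prems(1) by auto
  have "proots p = {#x#} + proots q" unfolding q using q0 by (subst proots_mult) auto
  then have "mset xs = proots q" using Cons.prems(2) by simp
  moreover have "length xs = degree q"
    using Cons.prems(3) q0 unfolding q by (simp add: degree_mult_eq del: mult_pCons_left)
  ultimately have "q = Polynomial.smult (lead_coeff q) (\<Prod>x\<leftarrow>xs. [:- x, 1:])" using Cons.IH[OF q0] by simp
  then have "p = [:- x, 1:] * Polynomial.smult (lead_coeff q) (\<Prod>x\<leftarrow>xs. [:- x, 1:])"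
    using q by simp
  moreover have "lead_coeff p = lead_coeff q" unfolding q lead_coeff_mult by simp
  ultimately show ?case by (simp only: mult_smult_right list.map prod_list.Cons)
qed

text \<open>\<open>w * (p - q)\<close> vanishes everywhere and so is zero. The pivots are quotients,
  defined only away from the roots of their denominators.\<close>

lemma poly_eq_if_eq_outside_roots:
  fixes p q w :: "real poly"
  assumes "w \<noteq> 0" "\<And>x. poly w x \<noteq> 0 \<Longrightarrow> poly p x = poly q x"
  shows "p = q"
proof -
  have "poly (w * (p - q)) x = 0" for x using assms(2)[of x] by auto
  then have "w * (p - q) = 0" using poly_all_0_iff_0 by blast
  then show ?thesis using assms(1) by simp
qed

text \<open>Telescoping: \<open>F j\<close> enters the \<open>j\<close>-th quotient with exponent
  \<open>n j\<close> and the next one with \<open>- n (Suc j)\<close>. This is the source of the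
  multiplicities.\<close>

lemma prod_quotient_powers:
  fixes F :: "nat \<Rightarrow> 'a :: field"
  assumes "F 0 = 1" "\<And>j. j \<le> m \<Longrightarrow> F j \<noteq> 0"
    and "\<And>j. 1 \<le> j \<Longrightarrow> j \<le> m \<Longrightarrow> n (Suc j) \<le> n j"
  shows "(\<Prod>j = 1..m. (F j / F (j - 1)) ^ n j) =
    (\<Prod>j = 1..m. F j ^ (n j - n (Suc j))) * F m ^ n (Suc m)"
  using assms(2,3)
proof (induction m)
  case (Suc m)
  have *: "F (Suc m) ^ n (Suc m) = F (Suc m) ^ (n (Suc m) - n (Suc (Suc m))) * F (Suc m) ^ n (Suc (Suc m))"
    using Suc.prems(2)[of "Suc m"] by (simp flip: power_add)
  have "(\<Prod>j = 1..Suc m. (F j / F (j - 1)) ^ n j) =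
    (\<Prod>j = 1..m. F j ^ (n j - n (Suc j))) * F m ^ n (Suc m) * (F (Suc m) / F m) ^ n (Suc m)"
    using Suc by simp
  also have "\<dots> = (\<Prod>j = 1..m. F j ^ (n j - n (Suc j))) * F (Suc m) ^ n (Suc m)"
    using Suc.prems(1)[of m] by (simp add: power_divide)
  also have "\<dots> = (\<Prod>j = 1..Suc m. F j ^ (n j - n (Suc j))) * F (Suc m) ^ n (Suc (Suc m))"
    unfolding * by simp
  finally show ?case .
qed (simp add: assms(1))

section \<open>Characteristic polynomials of \<open>T_sub\<close>, \<open>S_mat\<close> and the
  rooted product\<close>

definition bethe_diag :: "real \<Rightarrow> (nat \<Rightarrow> nat) \<Rightarrow> nat \<Rightarrow> real" where
  "bethe_diag \<alpha> d i = \<alpha> * real (d (Suc i))"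

text \<open>The squared off-diagonal entry at \<open>(i, i + 1)\<close>. In a Bethe tree it is
  \<open>(1 - \<alpha>)\<^sup>2\<close> times the number of children of a vertex with index
  \<open>i + 2\<close>: its degree minus one, except at the root.\<close>

definition bethe_sq :: "real \<Rightarrow> (nat \<Rightarrow> nat) \<Rightarrow> nat \<Rightarrow> nat \<Rightarrow> real" where
  "bethe_sq \<alpha> d k i = (if i + 1 \<le> k - 2 then (1 - \<alpha>)\<^sup>2 * (real (d (i + 2)) - 1)
    else (1 - \<alpha>)\<^sup>2 * real (d k))"

text \<open>The lower bound on \<open>d\<close> makes every radicand nonnegative, so the roots
  square back. \<open>T_sub\<close> with \<open>j < k\<close> stops before the corner entry.\<close>

lemma char_poly_tridiag_mat:
  assumes d: "\<And>j. 2 \<le> j \<Longrightarrow> j < k \<Longrightarrow> 1 \<le> d j"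
  shows "char_poly (tridiag_mat \<alpha> d k c) = tridiag_poly ((bethe_diag \<alpha> d)(k - 1 := c)) (bethe_sq \<alpha> d k) k"
    and "j < k \<Longrightarrow> char_poly (T_sub \<alpha> d k j) = tridiag_poly (bethe_diag \<alpha> d) (bethe_sq \<alpha> d k) j"
proof -
  define b where "b i = (if i + 1 \<le> k - 2 then (1 - \<alpha>) * sqrt (real (d (i + 2)) - 1)
    else (1 - \<alpha>) * sqrt (real (d k)))" for i
  have b: "b i * b i = bethe_sq \<alpha> d k i" if "Suc i < k" for i
  proof (cases "i + 1 \<le> k - 2")
    case True
    then have "1 \<le> d (i + 2)" using d[of "i + 2"] that by auto
    then have "sqrt (real (d (i + 2)) - 1) * sqrt (real (d (i + 2)) - 1) = real (d (i + 2)) - 1" by simp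
    moreover have "b i * b i = (1 - \<alpha>)\<^sup>2 * (sqrt (real (d (i + 2)) - 1) * sqrt (real (d (i + 2)) - 1))"
      using True by (simp add: b_def power2_eq_square)
    ultimately show ?thesis using True by (simp add: bethe_sq_def)
  next
    case False
    then show ?thesis by (simp add: b_def bethe_sq_def power2_eq_square)
  qed
  have "tridiag_mat \<alpha> d k c = mat k k (\<lambda>(i, j). if i = j then ((bethe_diag \<alpha> d)(k - 1 := c)) i
    else if j = Suc i then b i else if i = Suc j then b j else 0)"
    by (rule eq_matI) (auto simp: tridiag_mat_def b_def bethe_diag_def)
  then show "char_poly (tridiag_mat \<alpha> d k c) = tridiag_poly ((bethe_diag \<alpha> d)(k - 1 := c)) (bethe_sq \<alpha> d k) k"
    unfolding char_poly_tridiagonal by (auto intro: tridiag_poly_cong b simp: char_poly_tridiagonal)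
  assume j: "j < k"
  have "T_sub \<alpha> d k j = mat j j (\<lambda>(i, j). if i = j then bethe_diag \<alpha> d i
    else if j = Suc i then b i else if i = Suc j then b j else 0)"
    using j by (intro eq_matI) (auto simp: T_sub_def T_mat_def tridiag_mat_def b_def bethe_diag_def)
  then show "char_poly (T_sub \<alpha> d k j) = tridiag_poly (bethe_diag \<alpha> d) (bethe_sq \<alpha> d k) j"
    using j by (simp add: char_poly_tridiagonal) (intro tridiag_poly_cong refl b; simp)
qed

context bethe_tree
begin

abbreviation "d \<equiv> bethe_d N E k"
abbreviation "n \<equiv> bethe_n N E k"

text \<open>The vertices other than the root are grouped by level, as the pivots depend on nothing
  else.\<close>

lemma prod_levels:
  fixes h :: "nat \<Rightarrow> real"
  shows "(\<Prod>u = 1..<N. h (Suc (k - level E u))) = (\<Prod>j = 1..k - 1. h j ^ n j)"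
proof -
  have "(\<Prod>j = 1..k - 1. \<Prod>u\<in>{u \<in> {1..<N}. Suc (k - level E u) = j}. h (Suc (k - level E u))) =
    (\<Prod>u = 1..<N. h (Suc (k - level E u)))"
  proof (rule prod.group)
    have "level E u \<ge> 2" if "1 \<le> u" "u < N" for u
      using level_bounds[OF that(2)] level_eq_1[OF that(2)] that by linarith
    then show "(\<lambda>u. Suc (k - level E u)) ` {1..<N} \<subseteq> {1..k - 1}"
      using k2 by fastforce
  qed auto
  moreover have "(\<Prod>u\<in>{u \<in> {1..<N}. Suc (k - level E u) = j}. h (Suc (k - level E u))) = h j ^ n j"
    if j: "j \<in> {1..k - 1}" for j
  proof -
    have "{u \<in> {1..<N}. Suc (k - level E u) = j} = {v. v < N \<and> level E v = k - j + 1}"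
    proof (intro equalityI subsetI)
      fix u assume u: "u \<in> {v. v < N \<and> level E v = k - j + 1}"
      then have "u \<noteq> 0" using level_eq_1[of u] j by auto
      then show "u \<in> {u \<in> {1..<N}. Suc (k - level E u) = j}" using u j by auto
    next
      fix u assume "u \<in> {u \<in> {1..<N}. Suc (k - level E u) = j}"
      then show "u \<in> {v. v < N \<and> level E v = k - j + 1}" using level_bounds[of u] by auto
    qed
    then have "card {u \<in> {1..<N}. Suc (k - level E u) = j} = n j" by (simp add: bethe_n_def)
    moreover have "(\<Prod>u\<in>{u \<in> {1..<N}. Suc (k - level E u) = j}. h (Suc (k - level E u))) =
      (\<Prod>u\<in>{u \<in> {1..<N}. Suc (k - level E u) = j}. h j)" by (rule prod.cong) auto
    ultimately show ?thesis by simp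
  qed
  ultimately show ?thesis by simp
qed

text \<open>Dividing the recurrence of \<open>P\<close> by the previous value gives the pivot
  equations, since \<open>bethe_sq\<close> counts children. The root block yields the quotients of
  \<open>Q i\<close> by \<open>P (k - 1)\<close>, and the remaining pivots telescope.\<close>

lemma char_poly_rooted_bethe:
  fixes \<alpha> :: real and \<rho> :: "nat \<Rightarrow> real"
  assumes ER: "simple_graph r ER" and r: "r > 0"
    and \<rho>: "char_poly (A_alpha \<alpha> r ER) = (\<Prod>i = 1..r. [:- \<rho> i, 1:])"
  defines "P \<equiv> tridiag_poly (bethe_diag \<alpha> d) (bethe_sq \<alpha> d k)"
    and "Q \<equiv> \<lambda>i. tridiag_poly ((bethe_diag \<alpha> d)(k - 1 := \<alpha> * real (d k) + \<rho> i)) (bethe_sq \<alpha> d k) k"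
  shows "char_poly (A_alpha \<alpha> (r * N) (rooted_product r ER N E)) =
    (\<Prod>j = 1..k - 1. P j ^ (r * (n j - n (j + 1)))) * (\<Prod>i = 1..r. Q i)"
proof (rule poly_eq_if_eq_outside_roots[of "\<Prod>j\<le>k - 1. P j"])
  have "P j \<noteq> 0" for j using degree_tridiag_poly(2)[of "bethe_diag \<alpha> d" "bethe_sq \<alpha> d k" j] by (auto simp: P_def)
  then show "(\<Prod>j\<le>k - 1. P j) \<noteq> 0" by simp
next
  fix x assume "poly (\<Prod>j\<le>k - 1. P j) x \<noteq> 0"
  then have nz: "poly (P j) x \<noteq> 0" if "j \<le> k - 1" for j using that by (auto simp: poly_prod)
  define F where "F j = poly (P j) x" for j
  define \<beta> where "\<beta> = 1 - \<alpha>"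
  have F0: "F 0 = 1" "F 1 = x - \<alpha> * real (d 1)" by (simp_all add: F_def P_def bethe_diag_def)
  have Frec: "F (Suc (Suc f)) = (x - \<alpha> * real (d (Suc (Suc f)))) * F (Suc f) - bethe_sq \<alpha> d k f * F f" for f
    by (simp add: F_def P_def bethe_diag_def algebra_simps)
  have Fnz: "F j \<noteq> 0" if "j < k" for j using nz[of j] that by (simp add: F_def)
  define p where "p u = F (Suc (k - level E u)) / F (k - level E u)" for u
  \<comment> \<open>Forced by the equation at the root, whose \<open>d k\<close> children all have
    pivot \<open>F (k - 1) / F (k - 2)\<close>.\<close>
  define c where "c = x - \<alpha> * real (d k) - \<beta>\<^sup>2 * real (d k) * F (k - 2) / F (k - 1)"
  have lev2: "level E u \<ge> 2" if "u < N" "u \<noteq> 0" for u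
    using level_bounds[OF that(1)] level_eq_1[OF that(1)] that by linarith
  have sum_ch: "(\<Sum>w\<in>ch u. \<beta>\<^sup>2 / p w) = real (card (ch u)) * (\<beta>\<^sup>2 * F f / F (Suc f))"
    if "u < N" "k - level E u = Suc f" for u f
  proof -
    have "\<beta>\<^sup>2 / p w = \<beta>\<^sup>2 * F f / F (Suc f)" if "w \<in> ch u" for w
    proof -
      have "level E w = Suc (level E u)" using that level_par by (auto simp: ch_def)
      then have "k - level E w = f" using \<open>k - level E u = Suc f\<close> by simp
      then show ?thesis by (simp add: p_def)
    qed
    then show ?thesis by simp
  qed
  have "poly (char_poly (A_alpha \<alpha> (r * N) (rooted_product r ER N E))) x =
    poly (char_poly (A_alpha \<alpha> r ER)) c * (\<Prod>u = 1..<N. p u) ^ r"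
  proof (rule char_poly_rooted_product[OF ER r], fold \<beta>_def)
    fix u assume u: "u < N" "u \<noteq> 0"
    show "p u \<noteq> 0" using Fnz lev2[OF u] level_bounds[OF u(1)] by (auto simp: p_def)
    show "x - \<alpha> * real (gdeg N E u) = p u + (\<Sum>w\<in>ch u. \<beta>\<^sup>2 / p w)"
    proof (cases "k - level E u")
      case 0
      then have "level E u = k" using level_bounds[OF u(1)] by simp
      then show ?thesis using ch_leaf[of u] bethe_d_eq[OF u(1)] F0 by (simp add: p_def)
    next
      case (Suc f)
      have deg: "real (gdeg N E u) = real (d (Suc (Suc f)))" using bethe_d_eq[OF u(1)] Suc by simp
      \<comment> \<open>As \<open>u\<close> is not the root, \<open>f + 1 \<le> k - 2\<close>, so
        the first case of \<open>bethe_sq\<close> applies.\<close>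
      have sq: "bethe_sq \<alpha> d k f = \<beta>\<^sup>2 * real (card (ch u))"
        using lev2[OF u] Suc card_ch_eq[OF u] by (auto simp: bethe_sq_def \<beta>_def)
      have "F (Suc f) \<noteq> 0" using Fnz Suc lev2[OF u] by auto
      then show ?thesis unfolding sum_ch[OF u(1) Suc] deg
        unfolding p_def Suc Frec sq by (simp add: field_simps)
    qed
  next
    obtain f where f: "k = Suc (Suc f)" using k2 by (metis add_2_eq_Suc le_Suc_ex)
    have l0: "k - level E 0 = Suc f" using level_eq_1[of 0] N_pos f by simp
    have deg: "gdeg N E 0 = d k" using bethe_d_eq[of 0] N_pos l0 f by simp
    show "x - \<alpha> * real (gdeg N E 0) = c + (\<Sum>w\<in>ch 0. \<beta>\<^sup>2 / p w)"
      unfolding sum_ch[OF N_pos l0] deg card_ch_root c_def by (simp add: f)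
  qed
  also have "poly (char_poly (A_alpha \<alpha> r ER)) c = (\<Prod>i = 1..r. c - \<rho> i)"
    unfolding \<rho> by (simp add: poly_prod)
  also have "\<dots> = (\<Prod>i = 1..r. poly (Q i) x / F (k - 1))"
  proof (rule prod.cong[OF refl])
    fix i
    obtain f where f: "k = Suc (Suc f)" using k2 by (metis add_2_eq_Suc le_Suc_ex)
    have cong: "tridiag_poly ((bethe_diag \<alpha> d)(Suc f := y)) (bethe_sq \<alpha> d k) j = P j" if "j \<le> Suc f" for j y
      unfolding P_def by (rule tridiag_poly_cong) (use that in auto)
    have "poly (Q i) x = (x - (\<alpha> * real (d k) + \<rho> i)) * F (Suc f) - bethe_sq \<alpha> d k f * F f"
      unfolding Q_def F_def using cong[of f] cong[of "Suc f"] by (simp add: f algebra_simps)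
    also have "bethe_sq \<alpha> d k f = \<beta>\<^sup>2 * real (d k)" by (simp add: bethe_sq_def f \<beta>_def)
    finally show "c - \<rho> i = poly (Q i) x / F (k - 1)"
      using Fnz[of "Suc f"] by (simp add: c_def f field_simps)
  qed
  also have "\<dots> = (\<Prod>i = 1..r. poly (Q i) x) / F (k - 1) ^ r" by (simp add: prod_dividef)
  also have "(\<Prod>u = 1..<N. p u) = (\<Prod>j = 1..k - 1. (F j / F (j - 1)) ^ n j)"
    unfolding p_def using prod_levels[of "\<lambda>j. F j / F (j - 1)"] by simp
  also have "\<dots> = (\<Prod>j = 1..k - 1. F j ^ (n j - n (Suc j))) * F (k - 1) ^ n (Suc (k - 1))"
    by (rule prod_quotient_powers) (use F0 Fnz bethe_n_antimono k2 in auto)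
  also have "n (Suc (k - 1)) = 1" using bethe_n_root k2 by simp
  \<comment> \<open>There is one root per copy, so the telescoped product leaves
    \<open>F (k - 1) ^ r\<close>, which cancels the denominator.\<close>
  also have "(\<Prod>i = 1..r. poly (Q i) x) / F (k - 1) ^ r *
      ((\<Prod>j = 1..k - 1. F j ^ (n j - n (Suc j))) * F (k - 1) ^ 1) ^ r =
      (\<Prod>j = 1..k - 1. F j ^ (r * (n j - n (Suc j)))) * (\<Prod>i = 1..r. poly (Q i) x)"
    using Fnz[of "k - 1"] k2
    by (simp add: power_mult_distrib prod_power_distrib mult.commute flip: power_mult)
  finally show "poly (char_poly (A_alpha \<alpha> (r * N) (rooted_product r ER N E))) x =
    poly ((\<Prod>j = 1..k - 1. P j ^ (r * (n j - n (j + 1)))) * (\<Prod>i = 1..r. Q i)) x"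
    by (simp add: F_def poly_prod)
qed

end

section \<open>Spectrum and spectral radius of the rooted product\<close>

lemma set_mset_repeat_mset: "set_mset (repeat_mset m M) = (if m = 0 then {} else set_mset M)"
  by (induction m) auto

lemma spectrum_map_of_real_iff:
  assumes A: "A \<in> carrier_mat m m"
  shows "z \<in> spectrum (map_mat complex_of_real A) \<longleftrightarrow>
    poly (map_poly complex_of_real (char_poly A)) z = 0"
proof -
  have "map_mat complex_of_real A \<in> carrier_mat m m" using A by simp
  from spectrum_root_char_poly[OF this] show ?thesis by (simp add: of_real_hom.char_poly_hom[OF A])
qed

theorem mainTheorem5:
  fixes r N k :: nat and ER EB :: "nat \<Rightarrow> nat \<Rightarrow> bool" and \<alpha> :: real and \<rho> :: "nat \<Rightarrow> real"
  assumes R: "connected_graph r ER"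
      and B: "gen_bethe_tree N EB k" and k: "k \<ge> 2"
      and \<alpha>: "0 \<le> \<alpha>" "\<alpha> < 1"
      and \<rho>: "mset (map \<rho> [1..<r+1]) = spec (A_alpha \<alpha> r ER)"
      and \<rho>1: "\<rho> 1 = spectral_radius (map_mat complex_of_real (A_alpha \<alpha> r ER))"
  defines "n \<equiv> bethe_n N EB k" and "d \<equiv> bethe_d N EB k"
      and "G \<equiv> A_alpha \<alpha> (r * N) (rooted_product r ER N EB)"
  shows "(set_mset (spec G) =
           (\<Union>j\<in>{1..k-1}. (if n j > n (j+1) then set_mset (spec (T_sub \<alpha> d k j)) else {}))
           \<union> (\<Union>i\<in>{1..r}. set_mset (spec (S_mat \<alpha> d k (\<rho> i))))) \<and>
         (spec G = (\<Sum>j\<in>{1..k-1}. repeat_mset (r * (n j - n (j+1))) (spec (T_sub \<alpha> d k j)))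
                  + (\<Sum>i\<in>{1..r}. spec (S_mat \<alpha> d k (\<rho> i)))) \<and>
         (Max (set_mset (spec (S_mat \<alpha> d k (\<rho> 1)))) =
           spectral_radius (map_mat complex_of_real G))"
proof -
  have tree: "is_tree N EB" using B unfolding gen_bethe_tree_def by simp
  interpret bethe_tree N EB k by unfold_locales (use tree B k in auto)
  have ER: "simple_graph r ER" and r: "r > 0" using R unfolding connected_graph_def by auto
  define a where "a = bethe_diag \<alpha> d"
  define s where "s = bethe_sq \<alpha> d k"
  define as where "as i = a(k - 1 := \<alpha> * real (d k) + \<rho> i)" for i
  let ?A = "A_alpha \<alpha> r ER"
  have A: "?A \<in> carrier_mat r r" by (simp add: A_alpha_def)
  have G: "G \<in> carrier_mat (r * N) (r * N)" by (simp add: G_def A_alpha_def)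
  have monA: "degree (char_poly ?A) = r" "lead_coeff (char_poly ?A) = 1"
    using degree_monic_char_poly[OF A] by auto
  then have "char_poly ?A = Polynomial.smult (lead_coeff (char_poly ?A)) (\<Prod>x\<leftarrow>map \<rho> [1..<r + 1]. [:- x, 1:])"
    by (intro poly_eq_prod_list_proots) (use \<rho> in \<open>auto simp: spec_def\<close>)
  also have "\<dots> = (\<Prod>i = 1..r. [:- \<rho> i, 1:])"
    using prod.distinct_set_conv_list[of "[1..<r + 1]" "\<lambda>i. [:- \<rho> i, 1:]"]
    unfolding monA(2) by (simp add: o_def atLeastLessThanSuc_atLeastAtMost del: upt_Suc)
  finally have cA: "char_poly ?A = (\<Prod>i = 1..r. [:- \<rho> i, 1:])" .
  have dge: "1 \<le> d j" if "2 \<le> j" "j < k" for j using bethe_d_ge_2[OF that] by (simp add: d_def)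
  have cT: "char_poly (T_sub \<alpha> d k j) = tridiag_poly a s j" if "j \<in> {1..k - 1}" for j
    unfolding a_def s_def by (rule char_poly_tridiag_mat(2)) (use dge that k in auto)
  have cS: "char_poly (S_mat \<alpha> d k (\<rho> i)) = tridiag_poly (as i) s k" for i
    unfolding a_def s_def as_def S_mat_def by (rule char_poly_tridiag_mat(1)) (use dge in auto)
  have cG: "char_poly G = (\<Prod>j = 1..k - 1. tridiag_poly a s j ^ (r * (n j - n (j + 1)))) * (\<Prod>i = 1..r. tridiag_poly (as i) s k)"
    unfolding G_def a_def s_def as_def d_def n_def by (rule char_poly_rooted_bethe[OF ER r cA])
  have nz: "tridiag_poly f g j \<noteq> 0" for f g :: "nat \<Rightarrow> real" and j
    using degree_tridiag_poly(2)[of f g j] by auto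
  have spec_G: "spec G = (\<Sum>j\<in>{1..k-1}. repeat_mset (r * (n j - n (j+1))) (spec (T_sub \<alpha> d k j)))
      + (\<Sum>i\<in>{1..r}. spec (S_mat \<alpha> d k (\<rho> i)))"
  proof -
    have "spec G = proots (\<Prod>j = 1..k - 1. tridiag_poly a s j ^ (r * (n j - n (j + 1)))) + proots (\<Prod>i = 1..r. tridiag_poly (as i) s k)"
      unfolding spec_def cG by (rule proots_mult) (auto simp: nz)
    also have "proots (\<Prod>j = 1..k - 1. tridiag_poly a s j ^ (r * (n j - n (j + 1)))) =
      (\<Sum>j\<in>{1..k-1}. repeat_mset (r * (n j - n (j+1))) (spec (T_sub \<alpha> d k j)))"
      by (subst proots_prod) (auto simp: nz proots_power spec_def cT intro!: sum.cong)
    also have "proots (\<Prod>i = 1..r. tridiag_poly (as i) s k) = (\<Sum>i\<in>{1..r}. spec (S_mat \<alpha> d k (\<rho> i)))"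
      by (subst proots_prod) (auto simp: nz spec_def cS)
    finally show ?thesis .
  qed
  have set_G: "set_mset (spec G) =
      (\<Union>j\<in>{1..k-1}. (if n j > n (j+1) then set_mset (spec (T_sub \<alpha> d k j)) else {}))
      \<union> (\<Union>i\<in>{1..r}. set_mset (spec (S_mat \<alpha> d k (\<rho> i))))"
  proof -
    \<comment> \<open>As \<open>r > 0\<close>, the multiplicity is zero exactly when
      \<open>n j \<le> n (j + 1)\<close>; such a \<open>T_sub\<close> adds nothing to the
      set.\<close>
    have rep: "set_mset (repeat_mset (r * (n j - n (j + 1))) M) = (if n j > n (j + 1) then set_mset M else {})"
      for j and M :: "real multiset" using r by (simp add: set_mset_repeat_mset)
    show ?thesis unfolding spec_G set_mset_union set_mset_sum[OF finite_atLeastAtMost] rep ..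
  qed
  have s_pos: "s i > 0" if "i < k - 1" for i
  proof (cases "i + 1 \<le> k - 2")
    case True
    then have "2 \<le> d (i + 2)" using bethe_d_ge_2[of "i + 2"] that by (simp add: d_def)
    then have "real (d (i + 2)) - 1 > 0" by linarith
    then show ?thesis using True \<alpha> by (simp add: s_def bethe_sq_def)
  next
    case False
    then show ?thesis using bethe_d_root \<alpha> by (simp add: s_def bethe_sq_def d_def)
  qed
  have "\<exists>l. poly (tridiag_poly (as 1) s (Suc (k - 1))) l = 0 \<and> (\<forall>j\<le>k - 1. poly (tridiag_poly (as 1) s j) l > 0) \<and>
    (\<forall>x>l. \<forall>j\<le>Suc (k - 1). poly (tridiag_poly (as 1) s j) x > 0)"
    by (rule tridiag_poly_top_root) (rule s_pos)
  then obtain l where l: "poly (tridiag_poly (as 1) s k) l = 0"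
    and lpos: "\<And>x j. x > l \<Longrightarrow> j \<le> k \<Longrightarrow> poly (tridiag_poly (as 1) s j) x > 0"
    using k by auto
  have specS: "set_mset (spec (S_mat \<alpha> d k (\<rho> 1))) = {x. poly (tridiag_poly (as 1) s k) x = 0}"
    unfolding spec_def cS using nz by simp
  have maxS: "Max (set_mset (spec (S_mat \<alpha> d k (\<rho> 1)))) = l"
  proof (rule Max_eqI)
    show "y \<le> l" if "y \<in> set_mset (spec (S_mat \<alpha> d k (\<rho> 1)))" for y
      using that lpos[of y k] unfolding specS by force
    show "l \<in> set_mset (spec (S_mat \<alpha> d k (\<rho> 1)))" using l unfolding specS by simp
  qed simp
  have \<rho>_le: "\<bar>\<rho> i\<bar> \<le> \<rho> 1" if "i \<in> {1..r}" for i
  proof -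
    have "poly (char_poly ?A) (\<rho> i) = 0" unfolding cA using that by (auto simp: poly_prod)
    then have "complex_of_real (\<rho> i) \<in> spectrum (map_mat complex_of_real ?A)"
      unfolding spectrum_map_of_real_iff[OF A] by simp
    then have "cmod (complex_of_real (\<rho> i)) \<le> spectral_radius (map_mat complex_of_real ?A)"
      using A r by (intro spectral_radius_mem_max(2)[of _ r] imageI) auto
    then show ?thesis using \<rho>1 by simp
  qed
  \<comment> \<open>Only the corner entry depends on \<open>i\<close>, and \<open>\<rho>_le\<close>
    bounds it; the other entries are nonnegative because \<open>\<alpha>\<close> is.\<close>
  have as_le: "cmod (complex_of_real (as i j)) \<le> as 1 j" if "i \<in> {1..r}" for i j
    using \<rho>_le[OF that] \<alpha> abs_triangle_ineq[of "\<alpha> * real (d k)" "\<rho> i"]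
    by (auto simp: as_def a_def bethe_diag_def)
  have outside: "poly (map_poly complex_of_real (tridiag_poly (as i) s j)) z \<noteq> 0"
    if "i \<in> {1..r}" "j \<le> k" "cmod z > l" for i j z
    unfolding map_poly_tridiag
  proof (rule tridiag_poly_nonzero_outside[of k _ "as 1"])
    show "s i \<ge> 0" if "Suc i < k" for i by (rule less_imp_le, rule s_pos) (use that in simp)
  qed (use that lpos as_le in auto)
  \<comment> \<open>Up to size \<open>k - 1\<close> the corner is not reached, so
    \<open>outside\<close> with \<open>i = 1\<close> also covers the factors from
    \<open>T_sub\<close>.\<close>
  have cong: "tridiag_poly a s j = tridiag_poly (as 1) s j" if "j \<in> {1..k - 1}" for j
    by (rule tridiag_poly_cong) (use that in \<open>auto simp: as_def\<close>)
  have upper: "cmod z \<le> l" if "z \<in> spectrum (map_mat complex_of_real G)" for z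
  proof (rule ccontr)
    assume "\<not> cmod z \<le> l"
    then have z: "l < cmod z" by simp
    interpret map_poly_comm_ring_hom complex_of_real ..
    have "poly (map_poly complex_of_real (char_poly G)) z \<noteq> 0"
      unfolding cG hom_distribs poly_mult poly_prod poly_power
      using outside[OF _ _ z] r by (auto simp: cong)
    then show False using that unfolding spectrum_map_of_real_iff[OF G] by simp
  qed
  have "poly (char_poly G) l = 0"
    unfolding cG poly_mult poly_prod using l r by auto
  then have mem: "complex_of_real l \<in> spectrum (map_mat complex_of_real G)"
    unfolding spectrum_map_of_real_iff[OF G] by simp
  \<comment> \<open>\<open>upper\<close> applied to \<open>l\<close> itself gives
    \<open>\<bar>l\<bar> \<le> l\<close>, so \<open>l\<close> is nonnegative.\<close>
  have cl: "cmod (complex_of_real l) = l" using upper[OF mem] by simp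
  have "spectral_radius (map_mat complex_of_real G) = l"
    unfolding spectral_radius_def
  proof (rule Max_eqI)
    show "finite (cmod ` spectrum (map_mat complex_of_real G))"
      using G by (intro finite_imageI card_finite_spectrum(1)[of _ "r * N"]) simp
    show "l \<in> cmod ` spectrum (map_mat complex_of_real G)" using imageI[OF mem, of cmod] cl by simp
  qed (use upper in auto)
  then show ?thesis using set_G spec_G maxS by simp
qed

end
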